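(* Let $x\in\mathscr{C}$ and $v\in\mathbb{R}^N$, and set $z_t=x+tv$ for $t\in\mathbb{R}$. If $Qx$ and $Qv$ are non-collinear, the following assertions hold. (i) If $\Upsilon(v;x)>0$, then the function $t\mapsto R(z_t)$, $t\in\mathbb{R}$, is minimum at $$\tau=\Upsilon(x;v)/\Upsilon(v;x);$$ in this case, $z_\tau\in\mathscr{C}$ and $R(z_\tau)=\min_{z\in\operatorname{span}\{x,v\}}R(z)$. (ii) If $\Upsilon(v;x)\leqslant 0$, then the function $t\mapsto R(z_t)$, $t\in\mathbb{R}$, is monotonic, and $$\inf_{t\in\mathbb{R}}R(z_t)=\min\{R(-v),R(v)\};$$ in particular, if $\Upsilon(v;x)=0$, then $\min_{z\in\operatorname{span}\{x,v\}}R(z)=\min\{R(-v),R(v)\}$. If $Qx$ and $Qv$ are collinear, then the map $R$ is piecewise-constant over $\operatorname{span}\{x,v\}$, taking the values $R(0)$ or $R(x)<R(0)$ (and $t\mapsto R(z_t)$ is thus minimum at $t=0$).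
   Context: Let $N\geqslant 1$ be an integer, let $Q\in\mathbb{R}^{N\times N}$ be a symmetric positive-semidefinite matrix, and let $c\in\mathbb{R}^N$ be a non-zero vector in the column space of $Q$. Fix $\alpha\in\mathbb{R}^N$ with $Q\alpha=c$. Vectors are column vectors. Two vectors are collinear if they are linearly dependent. The convex quadratic map $D:\mathbb{R}^N\to\mathbb{R}$ is $D(x)=x^TQx-2c^Tx+c^T\alpha$. Set $\mathscr{C}=\{x\in\mathbb{R}^N : c^Tx>0\}$ (for $x\in\mathscr{C}$ one has $x^TQx>0$). The relaxed map $R:\mathbb{R}^N\to\mathbb{R}$ is $R(x)=\min_{s\geqslant 0}D(sx)$, that is, $R(x)=c^T\alpha-(c^Tx)^2/(x^TQx)$ if $x\in\mathscr{C}$, and $R(x)=c^T\alpha$ otherwise. For $x,v\in\mathbb{R}^N$, set $\Upsilon(x;v)=(c^Tv)(x^TQx)-(c^Tx)(v^TQx)$; thus $\Upsilon(v;x)=(c^Tx)(v^TQv)-(c^Tv)(v^TQx)$. *)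

theory Defs
  imports "HOL-Analysis.Analysis"
begin

definition pos_semidef :: "real^'n^'n \<Rightarrow> bool" where
  "pos_semidef Q \<longleftrightarrow> transpose Q = Q \<and> (\<forall>x. 0 \<le> x \<bullet> (Q *v x))"

definition D_map :: "real^'n^'n \<Rightarrow> real^'n \<Rightarrow> real^'n \<Rightarrow> real^'n \<Rightarrow> real" where
  "D_map Q c \<alpha> x = x \<bullet> (Q *v x) - 2 * (c \<bullet> x) + c \<bullet> \<alpha>"

definition half_space :: "real^'n \<Rightarrow> (real^'n) set" where
  "half_space c = {x. c \<bullet> x > 0}"

text \<open>The minimum over \<open>s \<ge> 0\<close> is rendered as an infimum; that it is attained, and the usual
  closed form, are \<open>R_map_attained\<close> and \<open>R_map_closed_form\<close> below.\<close>

definition R_map :: "real^'n^'n \<Rightarrow> real^'n \<Rightarrow> real^'n \<Rightarrow> real^'n \<Rightarrow> real" where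
  "R_map Q c \<alpha> x = (INF s\<in>{0..}. D_map Q c \<alpha> (s *\<^sub>R x))"

definition Upsilon :: "real^'n^'n \<Rightarrow> real^'n \<Rightarrow> real^'n \<Rightarrow> real^'n \<Rightarrow> real" where
  "Upsilon Q c x v = (c \<bullet> v) * (x \<bullet> (Q *v x)) - (c \<bullet> x) * (v \<bullet> (Q *v x))"

text \<open>Linear dependence of the pair \<open>(u, v)\<close>. This is not \<open>dependent {u, v}\<close>, which is false
  for \<open>u = v \<noteq> 0\<close>.\<close>

definition collinear_vectors :: "'a::real_vector \<Rightarrow> 'a \<Rightarrow> bool" where
  "collinear_vectors u v \<longleftrightarrow> (\<exists>a b. (a \<noteq> 0 \<or> b \<noteq> 0) \<and> a *\<^sub>R u + b *\<^sub>R v = 0)"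

definition is_min_value :: "('a \<Rightarrow> real) \<Rightarrow> 'a set \<Rightarrow> real \<Rightarrow> bool" where
  "is_min_value f S m \<longleftrightarrow> m \<in> f ` S \<and> (\<forall>y\<in>S. m \<le> f y)"

text \<open>Convexity of the pieces plays the role of ``pieces are intervals'' in dimension one; without
  it the notion would only say that \<open>f\<close> takes finitely many values on \<open>S\<close>.\<close>

definition piecewise_constant_on :: "('a::real_vector \<Rightarrow> real) \<Rightarrow> 'a set \<Rightarrow> bool" where
  "piecewise_constant_on f S \<longleftrightarrow>
     (\<exists>P. finite P \<and> partition_on S P \<and> (\<forall>A\<in>P. convex A \<and> f constant_on A))"

lemma pos_semidef_symmetric:
  assumes "pos_semidef Q"
  shows "u \<bullet> (Q *v w) = w \<bullet> (Q *v u)"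
  using assms unfolding pos_semidef_def
  by (metis dot_lmul_matrix inner_commute transpose_matrix_vector)

lemma D_map_nonneg:
  assumes Q: "pos_semidef Q" and \<alpha>: "Q *v \<alpha> = c"
  shows "0 \<le> D_map Q c \<alpha> x"
proof -
  have "(x - \<alpha>) \<bullet> (Q *v (x - \<alpha>)) = D_map Q c \<alpha> x"
    using pos_semidef_symmetric[OF Q, of \<alpha> x] \<alpha>
    by (simp add: D_map_def matrix_vector_mult_diff_distrib inner_diff_left inner_diff_right
        inner_commute)
  then show ?thesis
    using Q unfolding pos_semidef_def by metis
qed

lemma half_space_quadratic_form_pos:
  assumes Q: "pos_semidef Q" and \<alpha>: "Q *v \<alpha> = c" and x: "x \<in> half_space c"
  shows "x \<bullet> (Q *v x) > 0"
proof (rule ccontr)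
  assume "\<not> ?thesis"
  then have q0: "x \<bullet> (Q *v x) = 0"
    using Q unfolding pos_semidef_def by (metis less_eq_real_def)
  have "c \<bullet> x > 0" using x by (simp add: half_space_def)
  define s where "s = (c \<bullet> \<alpha> + 1) / (2 * (c \<bullet> x))"
  have "2 * (s * (c \<bullet> x)) = c \<bullet> \<alpha> + 1"
    using \<open>c \<bullet> x > 0\<close> by (simp add: s_def)
  then have "D_map Q c \<alpha> (s *\<^sub>R x) = -1"
    by (simp add: D_map_def q0 matrix_vector_mult_scaleR)
  then show False using D_map_nonneg[OF Q \<alpha>, of "s *\<^sub>R x"] by simp
qed

lemma D_map_ray_min:
  fixes Q :: "real^'n^'n" and c \<alpha> x :: "real^'n"
  assumes Q: "pos_semidef Q" and \<alpha>: "Q *v \<alpha> = c"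
  defines "m \<equiv> (if x \<in> half_space c then c \<bullet> \<alpha> - (c \<bullet> x)\<^sup>2 / (x \<bullet> (Q *v x)) else c \<bullet> \<alpha>)"
  shows "is_min_value (\<lambda>s. D_map Q c \<alpha> (s *\<^sub>R x)) {0..} m"
proof -
  define p where "p = c \<bullet> x"
  define q where "q = x \<bullet> (Q *v x)"
  have D: "D_map Q c \<alpha> (s *\<^sub>R x) = s\<^sup>2 * q - 2 * (s * p) + c \<bullet> \<alpha>" for s
    by (simp add: D_map_def p_def q_def matrix_vector_mult_scaleR power2_eq_square)
  show ?thesis
  proof (cases "x \<in> half_space c")
    case True
    have q: "q > 0" using half_space_quadratic_form_pos[OF Q \<alpha> True] by (simp add: q_def)
    have p: "p > 0" using True by (simp add: half_space_def p_def)
    have D': "D_map Q c \<alpha> (s *\<^sub>R x) = q * (s - p / q)\<^sup>2 + m" for s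
      using q True
      by (simp add: D m_def p_def[symmetric] q_def[symmetric] power2_eq_square field_simps)
    have "m = D_map Q c \<alpha> ((p / q) *\<^sub>R x)" by (simp add: D')
    moreover have "p / q \<in> {0..}" using p q by simp
    ultimately show ?thesis
      using q unfolding is_min_value_def by (auto simp: D')
  next
    case False
    have q: "q \<ge> 0" using Q by (simp add: pos_semidef_def q_def)
    have p: "p \<le> 0" using False by (simp add: half_space_def p_def)
    have "m = D_map Q c \<alpha> (0 *\<^sub>R x)" using False by (simp only: D m_def) simp
    moreover have "m \<le> D_map Q c \<alpha> (s *\<^sub>R x)" if "s \<ge> 0" for s
      using False mult_nonneg_nonpos[OF that p] mult_nonneg_nonneg[OF zero_le_power2[of s] q]
      by (simp add: D m_def)
    ultimately show ?thesis unfolding is_min_value_def by force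
  qed
qed

lemma is_min_value_imp_INF:
  assumes "is_min_value f S m"
  shows "(INF y\<in>S. f y) = m"
  using assms unfolding is_min_value_def by (intro cInf_eq_minimum) auto

lemma R_map_closed_form:
  assumes "pos_semidef Q" and "Q *v \<alpha> = c"
  shows "R_map Q c \<alpha> x =
    (if x \<in> half_space c then c \<bullet> \<alpha> - (c \<bullet> x)\<^sup>2 / (x \<bullet> (Q *v x)) else c \<bullet> \<alpha>)"
  unfolding R_map_def by (rule is_min_value_imp_INF[OF D_map_ray_min[OF assms]])

lemma R_map_attained:
  assumes "pos_semidef Q" and "Q *v \<alpha> = c"
  shows "is_min_value (\<lambda>s. D_map Q c \<alpha> (s *\<^sub>R x)) {0..} (R_map Q c \<alpha> x)"
  unfolding R_map_closed_form[OF assms] by (rule D_map_ray_min[OF assms])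

lemma R_map_nonneg:
  assumes "pos_semidef Q" and "Q *v \<alpha> = c"
  shows "0 \<le> R_map Q c \<alpha> x"
  using R_map_attained[OF assms, of x] D_map_nonneg[OF assms] unfolding is_min_value_def by auto

end

theory Submission
  imports Defs
begin

text \<open>Write \<open>q w\<close> for \<open>w \<bullet> (Q *v w)\<close>. Since \<open>c = Q *v \<alpha>\<close>, the value of \<open>D_map\<close> at \<open>w\<close> is
  \<open>q (w - \<alpha>)\<close>, the squared \<open>Q\<close>-seminorm distance from \<open>w\<close> to \<open>\<alpha>\<close>, and the value of \<open>R_map\<close> is
  the squared distance from \<open>\<alpha>\<close> to the ray through \<open>w\<close>.

  Suppose that \<open>Q *v x\<close> and \<open>Q *v v\<close> are non-collinear. The Gram determinant
  \<open>\<Delta> = q x * q v - (x \<bullet> (Q *v v))\<^sup>2\<close> is then positive, and the \<open>Q\<close>-orthogonal projection of \<open>\<alpha>\<close> on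
  \<open>span {x, v}\<close> is given by Cramer's rule as \<open>g = (U *\<^sub>R x + W *\<^sub>R v) /\<^sub>R \<Delta>\<close>, where
  \<open>U = Upsilon Q c v x\<close> and \<open>W = Upsilon Q c x v\<close>. Among the vectors of the span, \<open>g\<close> minimizes
  \<open>D_map\<close>, hence also \<open>R_map\<close> (\<open>R_map_min_of_projection\<close>). As \<open>R_map\<close> is invariant under positive
  scaling, everything depends on where the ray through \<open>g\<close> lies. If \<open>U > 0\<close>, it meets the line
  \<open>x + t *\<^sub>R v\<close> at \<open>t = W / U\<close>. If \<open>U = 0\<close>, it is the ray of \<open>v\<close> or of \<open>- v\<close>. If \<open>U \<le> 0\<close>,
  then \<open>c \<bullet> v \<noteq> 0\<close>, and \<open>c \<bullet> v > 0\<close> may be assumed after reversing the line. The part of the line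
  inside \<open>half_space c\<close> is projected centrally on the hyperplane \<open>c \<bullet> w = 1\<close>. There \<open>R_map\<close> equals
  \<open>c \<bullet> \<alpha> - 1 / q w\<close>, and the sign of \<open>U\<close> makes \<open>q\<close> a quadratic polynomial with nonnegative
  coefficients in a positive parameter that decreases to \<open>0\<close> as \<open>t\<close> grows. This gives monotonicity and
  the infimum as a limit (\<open>antimono_R_map_line\<close>, \<open>INF_R_map_line\<close>).

  If \<open>Q *v x\<close> and \<open>Q *v v\<close> are collinear, then on the span both \<open>c \<bullet> w\<close> and \<open>q w\<close> depend on
  a single linear coordinate of \<open>w\<close>, and only the sign of this coordinate matters for \<open>R_map\<close>.\<close>

section \<open>The seminorm of a positive-semidefinite matrix\<close>

text \<open>A vector at which the form vanishes minimizes it, so the gradient vanishes there. The proof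
  moves from \<open>w\<close> a short distance in the direction opposite to the gradient.\<close>

lemma pos_semidef_quadratic_form_zero:
  fixes w :: "real^'n"
  assumes Q: "pos_semidef Q" and w: "w \<bullet> (Q *v w) = 0"
  shows "Q *v w = 0"
proof -
  define y where "y = Q *v w"
  define n where "n = y \<bullet> y"
  define k where "k = y \<bullet> (Q *v y)"
  define t where "t = n / (k + 1)"
  have k: "k \<ge> 0" using Q by (simp add: k_def pos_semidef_def)
  have "0 \<le> (w - t *\<^sub>R y) \<bullet> (Q *v (w - t *\<^sub>R y))"
    using Q by (simp add: pos_semidef_def)
  also have "\<dots> = t\<^sup>2 * k - 2 * t * n"
    using w pos_semidef_symmetric[OF Q, of w y]
    by (simp add: matrix_vector_mult_diff_distrib matrix_vector_mult_scaleR inner_diff_left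
        inner_diff_right k_def n_def y_def[symmetric] power2_eq_square algebra_simps)
  also have "\<dots> = - (n\<^sup>2 * (k + 2) / (k + 1)\<^sup>2)"
    using k by (simp add: t_def power2_eq_square divide_simps) (simp add: algebra_simps)
  finally have "n\<^sup>2 * ((k + 2) / (k + 1)\<^sup>2) \<le> 0" by simp
  moreover have "(k + 2) / (k + 1)\<^sup>2 > 0" using k by simp
  ultimately have "n\<^sup>2 \<le> 0" by (simp only: mult_le_0_iff) auto
  then show ?thesis by (simp add: n_def y_def)
qed

lemma pos_semidef_quadratic_form_pos:
  assumes "pos_semidef Q" and "Q *v w \<noteq> 0"
  shows "w \<bullet> (Q *v w) > 0"
  using assms pos_semidef_quadratic_form_zero[of Q w]
  unfolding pos_semidef_def by (metis less_eq_real_def)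

text \<open>The strict Cauchy--Schwarz inequality: the form is positive at the component of \<open>v\<close> that is
  \<open>Q\<close>-orthogonal to \<open>x\<close>.\<close>

lemma pos_semidef_gram_pos:
  assumes Q: "pos_semidef Q" and nc: "\<not> collinear_vectors (Q *v x) (Q *v v)"
  shows "(x \<bullet> (Q *v x)) * (v \<bullet> (Q *v v)) - (x \<bullet> (Q *v v))\<^sup>2 > 0"
proof -
  define a where "a = x \<bullet> (Q *v x)"
  define b where "b = x \<bullet> (Q *v v)"
  define d where "d = v \<bullet> (Q *v v)"
  define w where "w = a *\<^sub>R v - b *\<^sub>R x"
  have "Q *v x \<noteq> 0"
  proof
    assume "Q *v x = 0"
    then have "1 *\<^sub>R (Q *v x) + 0 *\<^sub>R (Q *v v) = 0" by simp
    then show False using nc unfolding collinear_vectors_def by (metis zero_neq_one)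
  qed
  then have a: "a > 0" using pos_semidef_quadratic_form_pos[OF Q] by (simp add: a_def)
  have "Q *v w = (- b) *\<^sub>R (Q *v x) + a *\<^sub>R (Q *v v)"
    by (simp add: w_def matrix_vector_mult_diff_distrib matrix_vector_mult_scaleR)
  then have "Q *v w \<noteq> 0"
    using nc a unfolding collinear_vectors_def by (metis less_irrefl)
  then have "0 < w \<bullet> (Q *v w)" by (rule pos_semidef_quadratic_form_pos[OF Q])
  also have "\<dots> = a * (a * d - b\<^sup>2)"
    using pos_semidef_symmetric[OF Q, of v x]
    by (simp add: w_def matrix_vector_mult_diff_distrib matrix_vector_mult_scaleR inner_diff_left
        inner_diff_right a_def[symmetric] b_def[symmetric] d_def[symmetric] power2_eq_square
        algebra_simps)
  finally show ?thesis
    using a by (simp add: zero_less_mult_iff a_def b_def d_def)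
qed

section \<open>Scaling and minimizers of the relaxed map\<close>

lemma R_map_le:
  assumes "pos_semidef Q" and "Q *v \<alpha> = c"
  shows "R_map Q c \<alpha> w \<le> c \<bullet> \<alpha>"
  using assms(1) by (simp add: R_map_closed_form[OF assms] pos_semidef_def)

lemma R_map_scaleR:
  assumes "pos_semidef Q" and "Q *v \<alpha> = c" and "s > 0"
  shows "R_map Q c \<alpha> (s *\<^sub>R w) = R_map Q c \<alpha> w"
  using assms(3)
  by (simp add: R_map_closed_form[OF assms(1,2)] half_space_def matrix_vector_mult_scaleR
      power_mult_distrib zero_less_mult_iff power2_eq_square)

text \<open>The hypothesis \<open>proj\<close> says that \<open>\<alpha> - g\<close> is \<open>Q\<close>-orthogonal to \<open>S\<close>. By Pythagoras, \<open>g\<close> then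
  minimizes \<open>D_map\<close> over \<open>S\<close>; since \<open>S\<close> contains the rays of its points, the bound passes to \<open>R_map\<close>.\<close>

lemma R_map_min_of_projection:
  assumes Q: "pos_semidef Q" and \<alpha>: "Q *v \<alpha> = c"
    and S: "subspace S" "g \<in> S" and proj: "\<And>w. w \<in> S \<Longrightarrow> c \<bullet> w = w \<bullet> (Q *v g)"
  shows "is_min_value (R_map Q c \<alpha>) S (R_map Q c \<alpha> g)"
proof -
  have D: "D_map Q c \<alpha> g \<le> D_map Q c \<alpha> w" if w: "w \<in> S" for w
  proof -
    have "0 \<le> (w - g) \<bullet> (Q *v (w - g))" using Q by (simp add: pos_semidef_def)
    also have "\<dots> = D_map Q c \<alpha> w - D_map Q c \<alpha> g"
      using proj[OF w] proj[OF S(2)] pos_semidef_symmetric[OF Q, of g w]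
      by (simp add: D_map_def matrix_vector_mult_diff_distrib inner_diff_left inner_diff_right)
    finally show ?thesis by simp
  qed
  have "R_map Q c \<alpha> g \<le> R_map Q c \<alpha> w" if w: "w \<in> S" for w
  proof -
    obtain s where "R_map Q c \<alpha> w = D_map Q c \<alpha> (s *\<^sub>R w)"
      using R_map_attained[OF Q \<alpha>, of w] unfolding is_min_value_def by auto
    moreover have "R_map Q c \<alpha> g \<le> D_map Q c \<alpha> (1 *\<^sub>R g)"
      using R_map_attained[OF Q \<alpha>, of g] unfolding is_min_value_def by (simp del: scaleR_one)
    ultimately show ?thesis
      using D[OF subspace_scale[OF S(1) w, of s]] by simp
  qed
  then show ?thesis using S(2) by (auto simp: is_min_value_def)
qed

lemma mem_span_pair:
  "w \<in> span {x, v} \<longleftrightarrow> (\<exists>s u. w = s *\<^sub>R x + u *\<^sub>R v)" for x v :: "'a::real_vector"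
proof
  assume "w \<in> span {x, v}"
  then obtain s u where "w - s *\<^sub>R x = u *\<^sub>R v" by (auto simp: span_insert span_singleton)
  then have "w = s *\<^sub>R x + u *\<^sub>R v" by (simp add: algebra_simps)
  then show "\<exists>s u. w = s *\<^sub>R x + u *\<^sub>R v" by blast
qed (auto intro: span_add span_scale span_base)

text \<open>The projection of \<open>\<alpha>\<close> is the solution of a linear system with the Gram matrix of \<open>x\<close> and \<open>v\<close>;
  the two values of \<open>Upsilon\<close> are the numerators in Cramer's rule.\<close>

lemma Upsilon_projection:
  assumes Q: "pos_semidef Q" and \<alpha>: "Q *v \<alpha> = c"
    and nc: "\<not> collinear_vectors (Q *v x) (Q *v v)"
    and \<Delta>: "\<Delta> = (x \<bullet> (Q *v x)) * (v \<bullet> (Q *v v)) - (x \<bullet> (Q *v v))\<^sup>2"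
    and g: "g = (Upsilon Q c v x / \<Delta>) *\<^sub>R x + (Upsilon Q c x v / \<Delta>) *\<^sub>R v"
    and w: "w \<in> span {x, v}"
  shows "c \<bullet> w = w \<bullet> (Q *v g)"
proof -
  have \<Delta>0: "\<Delta> \<noteq> 0" using pos_semidef_gram_pos[OF Q nc] \<Delta> by simp
  have vx: "v \<bullet> (Q *v x) = x \<bullet> (Q *v v)" by (rule pos_semidef_symmetric[OF Q])
  have Qg: "y \<bullet> (Q *v g)
      = (Upsilon Q c v x * (y \<bullet> (Q *v x)) + Upsilon Q c x v * (y \<bullet> (Q *v v))) / \<Delta>" for y
    using \<Delta>0 by (simp add: g matrix_vector_right_distrib matrix_vector_mult_scaleR
        inner_add_right field_simps)
  have "x \<bullet> (Q *v g) = (c \<bullet> x) * \<Delta> / \<Delta>"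
    unfolding Qg by (simp add: Upsilon_def vx \<Delta> power2_eq_square algebra_simps)
  moreover have "v \<bullet> (Q *v g) = (c \<bullet> v) * \<Delta> / \<Delta>"
    unfolding Qg by (simp add: Upsilon_def vx \<Delta> power2_eq_square algebra_simps)
  moreover obtain s u where "w = s *\<^sub>R x + u *\<^sub>R v" using w by (auto simp: mem_span_pair)
  ultimately show ?thesis using \<Delta>0 by (simp add: inner_add_left inner_add_right)
qed

section \<open>Monotonicity along a line\<close>

text \<open>Central projection on the hyperplane \<open>c \<bullet> w = 1\<close> sends \<open>x + t *\<^sub>R v\<close> to \<open>m + e *\<^sub>R k\<close>, where
  \<open>m\<close> is the image of \<open>v\<close>, \<open>k = x - (c \<bullet> x) *\<^sub>R m\<close>, and \<open>e\<close> is the inverse of \<open>c \<bullet> (x + t *\<^sub>R v)\<close>. The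
  polynomial below is the form at this point; its linear coefficient is \<open>2 * (k \<bullet> (Q *v m))\<close>, which
  is a positive multiple of \<open>- Upsilon Q c v x\<close>.\<close>

lemma R_map_line:
  fixes Q :: "real^'n^'n"
  assumes Q: "pos_semidef Q" and \<alpha>: "Q *v \<alpha> = c"
    and v: "v \<in> half_space c" and U: "Upsilon Q c v x \<le> 0"
  obtains A B C where "A > 0" "B \<ge> 0" "C \<ge> 0" "R_map Q c \<alpha> v = c \<bullet> \<alpha> - 1 / A"
    and "\<And>t e. c \<bullet> x + t * (c \<bullet> v) > 0 \<Longrightarrow> e = 1 / (c \<bullet> x + t * (c \<bullet> v)) \<Longrightarrow>
      R_map Q c \<alpha> (x + t *\<^sub>R v) = c \<bullet> \<alpha> - 1 / (A + B * e + C * e\<^sup>2)"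
proof -
  define p where "p = c \<bullet> x"
  define r where "r = c \<bullet> v"
  define m where "m = (1 / r) *\<^sub>R v"
  define k where "k = x - p *\<^sub>R m"
  define A where "A = m \<bullet> (Q *v m)"
  define B where "B = 2 * (k \<bullet> (Q *v m))"
  define C where "C = k \<bullet> (Q *v k)"
  have r: "r > 0" using v by (simp add: half_space_def r_def)
  have cm: "c \<bullet> m = 1" and ck: "c \<bullet> k = 0"
    using r by (simp_all add: m_def k_def inner_diff_right p_def r_def)
  have m: "m \<in> half_space c" by (simp add: half_space_def cm)
  have line: "R_map Q c \<alpha> (m + e *\<^sub>R k) = c \<bullet> \<alpha> - 1 / (A + B * e + C * e\<^sup>2)" for e
  proof -
    have "(m + e *\<^sub>R k) \<bullet> (Q *v (m + e *\<^sub>R k)) = A + B * e + C * e\<^sup>2"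
      using pos_semidef_symmetric[OF Q, of m k]
      by (simp add: A_def B_def C_def matrix_vector_right_distrib matrix_vector_mult_scaleR
          inner_add_left inner_add_right power2_eq_square algebra_simps)
    then show ?thesis
      by (simp add: R_map_closed_form[OF Q \<alpha>] half_space_def inner_add_right cm ck)
  qed
  show ?thesis
  proof (rule that[of A B C])
    show "A > 0" using half_space_quadratic_form_pos[OF Q \<alpha> m] by (simp add: A_def)
    show "C \<ge> 0" using Q by (simp add: pos_semidef_def C_def)
    have "B = - 2 * Upsilon Q c v x / r\<^sup>2"
      using r by (simp add: B_def k_def m_def Upsilon_def matrix_vector_mult_scaleR inner_diff_left
          p_def[symmetric] r_def[symmetric] power2_eq_square field_simps)
    then show "B \<ge> 0" using U by (simp add: divide_nonpos_nonneg)
    show "R_map Q c \<alpha> v = c \<bullet> \<alpha> - 1 / A"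
      using line[of 0] R_map_scaleR[OF Q \<alpha>, of "1 / r" v] r by (simp add: m_def)
    fix t e
    assume y: "c \<bullet> x + t * (c \<bullet> v) > 0" and e: "e = 1 / (c \<bullet> x + t * (c \<bullet> v))"
    have "e * (p + t * r) = 1" using y e by (simp add: p_def r_def)
    then have "1 - e * p = e * t * r" by (simp add: algebra_simps)
    moreover have "m + e *\<^sub>R k = e *\<^sub>R x + (1 - e * p) *\<^sub>R m"
      by (simp add: k_def algebra_simps)
    ultimately have "m + e *\<^sub>R k = e *\<^sub>R x + (e * t * r) *\<^sub>R m" by simp
    also have "\<dots> = e *\<^sub>R (x + t *\<^sub>R v)"
      using r by (simp add: m_def scaleR_add_right)
    finally show "R_map Q c \<alpha> (x + t *\<^sub>R v) = c \<bullet> \<alpha> - 1 / (A + B * e + C * e\<^sup>2)"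
      using line[of e] R_map_scaleR[OF Q \<alpha>, of e "x + t *\<^sub>R v"] y e by simp
  qed
qed

text \<open>Outside \<open>half_space c\<close> the map has its largest value; inside, the parameter \<open>e\<close> of
  \<open>R_map_line\<close> decreases as \<open>t\<close> grows.\<close>

lemma antimono_R_map_line:
  assumes Q: "pos_semidef Q" and \<alpha>: "Q *v \<alpha> = c"
    and v: "v \<in> half_space c" and U: "Upsilon Q c v x \<le> 0"
  shows "antimono (\<lambda>t. R_map Q c \<alpha> (x + t *\<^sub>R v))"
proof (rule antimonoI)
  obtain A B C where ABC: "A > 0" "B \<ge> 0" "C \<ge> 0"
    and line: "\<And>t e. c \<bullet> x + t * (c \<bullet> v) > 0 \<Longrightarrow> e = 1 / (c \<bullet> x + t * (c \<bullet> v)) \<Longrightarrow>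
      R_map Q c \<alpha> (x + t *\<^sub>R v) = c \<bullet> \<alpha> - 1 / (A + B * e + C * e\<^sup>2)"
    using R_map_line[OF assms] by metis
  fix t s :: real
  assume ts: "t \<le> s"
  show "R_map Q c \<alpha> (x + s *\<^sub>R v) \<le> R_map Q c \<alpha> (x + t *\<^sub>R v)"
  proof (cases "c \<bullet> x + t * (c \<bullet> v) > 0")
    case False
    then have "R_map Q c \<alpha> (x + t *\<^sub>R v) = c \<bullet> \<alpha>"
      by (simp add: R_map_closed_form[OF Q \<alpha>] half_space_def inner_add_right)
    then show ?thesis using R_map_le[OF Q \<alpha>] by simp
  next
    case t: True
    define e where "e = 1 / (c \<bullet> x + t * (c \<bullet> v))"
    define f where "f = 1 / (c \<bullet> x + s * (c \<bullet> v))"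
    have "t * (c \<bullet> v) \<le> s * (c \<bullet> v)"
      using ts v by (intro mult_right_mono) (auto simp: half_space_def)
    then have s: "c \<bullet> x + s * (c \<bullet> v) > 0" and fe: "0 \<le> f" "f \<le> e"
      using t by (auto simp: e_def f_def intro: divide_left_mono)
    have "A + B * f + C * f\<^sup>2 \<le> A + B * e + C * e\<^sup>2"
      using ABC fe by (intro add_mono mult_left_mono power_mono) auto
    moreover have "A + B * f + C * f\<^sup>2 > 0"
      using ABC fe by (intro add_pos_nonneg) auto
    ultimately have "1 / (A + B * e + C * e\<^sup>2) \<le> 1 / (A + B * f + C * f\<^sup>2)"
      by (intro divide_left_mono) auto
    then show ?thesis by (simp add: line[OF t e_def] line[OF s f_def])
  qed
qed

lemma INF_R_map_line:
  assumes Q: "pos_semidef Q" and \<alpha>: "Q *v \<alpha> = c"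
    and v: "v \<in> half_space c" and U: "Upsilon Q c v x \<le> 0"
  shows "(INF t. R_map Q c \<alpha> (x + t *\<^sub>R v)) = R_map Q c \<alpha> v"
proof -
  obtain A B C where ABC: "A > 0" "B \<ge> 0" "C \<ge> 0" and Rv: "R_map Q c \<alpha> v = c \<bullet> \<alpha> - 1 / A"
    and line: "\<And>t e. c \<bullet> x + t * (c \<bullet> v) > 0 \<Longrightarrow> e = 1 / (c \<bullet> x + t * (c \<bullet> v)) \<Longrightarrow>
      R_map Q c \<alpha> (x + t *\<^sub>R v) = c \<bullet> \<alpha> - 1 / (A + B * e + C * e\<^sup>2)"
    using R_map_line[OF assms] by metis
  let ?f = "\<lambda>t. R_map Q c \<alpha> (x + t *\<^sub>R v)"
  let ?y = "\<lambda>t. c \<bullet> x + t * (c \<bullet> v)"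
  have y: "filterlim ?y at_top at_top"
  proof (rule filterlim_tendsto_add_at_top[OF tendsto_const])
    show "filterlim (\<lambda>t. t * (c \<bullet> v)) at_top at_top"
      using v by (intro filterlim_at_top_mult_tendsto_pos[OF tendsto_const _ filterlim_ident])
        (simp add: half_space_def)
  qed
  have "((\<lambda>t. 1 / ?y t) \<longlongrightarrow> 0) at_top"
    by (intro tendsto_divide_0[OF tendsto_const] filterlim_at_top_imp_at_infinity y)
  then have "((\<lambda>t. c \<bullet> \<alpha> - 1 / (A + B * (1 / ?y t) + C * (1 / ?y t)\<^sup>2))
      \<longlongrightarrow> c \<bullet> \<alpha> - 1 / (A + B * 0 + C * 0\<^sup>2)) at_top"
    using ABC(1) by (intro tendsto_intros) auto
  moreover have "\<forall>\<^sub>F t in at_top. c \<bullet> \<alpha> - 1 / (A + B * (1 / ?y t) + C * (1 / ?y t)\<^sup>2) = ?f t"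
    using filterlim_at_top_dense[THEN iffD1, OF y, rule_format, of 0]
    by eventually_elim (simp add: line)
  ultimately have lim: "(?f \<longlongrightarrow> R_map Q c \<alpha> v) at_top"
    using Rv by (auto intro: Lim_transform_eventually)
  have bdd: "bdd_below (range ?f)"
    using R_map_nonneg[OF Q \<alpha>] by (intro bdd_belowI2[where m = 0])
  have anti: "antimono ?f" by (rule antimono_R_map_line[OF assms])
  show ?thesis
  proof (rule antisym)
    show "(INF t. ?f t) \<le> R_map Q c \<alpha> v"
      by (rule tendsto_lowerbound[OF lim]) (auto intro!: always_eventually cINF_lower bdd)
    show "R_map Q c \<alpha> v \<le> (INF t. ?f t)"
    proof (rule cINF_greatest)
      fix t
      have "\<forall>\<^sub>F s in at_top. ?f s \<le> ?f t"
        using eventually_ge_at_top[of t] by eventually_elim (rule antimonoD[OF anti])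
      then show "R_map Q c \<alpha> v \<le> ?f t" by (intro tendsto_upperbound[OF lim]) auto
    qed simp
  qed
qed

section \<open>Minimization over the span of two vectors\<close>

theorem theorem3p2:
  fixes Q :: "real^'n^'n" and c \<alpha> x v :: "real^'n"
    and R :: "real^'n \<Rightarrow> real" and z :: "real \<Rightarrow> real^'n"
  assumes Q: "pos_semidef Q"
    and c_nonzero: "c \<noteq> 0"
    and c_column_space: "c \<in> span (columns Q)"
    and \<alpha>: "Q *v \<alpha> = c"
    and R: "R = R_map Q c \<alpha>"
    and x: "x \<in> half_space c"
    and z: "z = (\<lambda>t. x + t *\<^sub>R v)"
  shows
    "(\<not> collinear_vectors (Q *v x) (Q *v v) \<longrightarrow>
        (Upsilon Q c v x > 0 \<longrightarrow>
           (let \<tau> = Upsilon Q c x v / Upsilon Q c v x in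
              is_arg_min (\<lambda>t. R (z t)) (\<lambda>t. True) \<tau> \<and>
              z \<tau> \<in> half_space c \<and>
              is_min_value R (span {x, v}) (R (z \<tau>)))) \<and>
        (Upsilon Q c v x \<le> 0 \<longrightarrow>
           (mono (\<lambda>t. R (z t)) \<or> antimono (\<lambda>t. R (z t))) \<and>
           (INF t. R (z t)) = min (R (- v)) (R v) \<and>
           (Upsilon Q c v x = 0 \<longrightarrow>
              is_min_value R (span {x, v}) (min (R (- v)) (R v)))))
     \<and>
     (collinear_vectors (Q *v x) (Q *v v) \<longrightarrow>
        piecewise_constant_on R (span {x, v}) \<and>
        R ` span {x, v} = {R 0, R x} \<and>
        R x < R 0 \<and>
        is_arg_min (\<lambda>t. R (z t)) (\<lambda>t. True) 0)"
proof -
  define p where "p = c \<bullet> x"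
  define r where "r = c \<bullet> v"
  define a where "a = x \<bullet> (Q *v x)"
  define b where "b = x \<bullet> (Q *v v)"
  define d where "d = v \<bullet> (Q *v v)"
  define U where "U = Upsilon Q c v x"
  define W where "W = Upsilon Q c x v"
  have p: "p > 0" using x by (simp add: p_def half_space_def)
  have a: "a > 0" using half_space_quadratic_form_pos[OF Q \<alpha> x] by (simp add: a_def)
  have U_eq: "U = p * d - r * b"
    by (simp add: U_def Upsilon_def p_def d_def r_def b_def)
  have z_span: "z t \<in> span {x, v}" for t
    unfolding z mem_span_pair by (metis scaleR_one)
  have noncollinear:
    "(U > 0 \<longrightarrow> is_arg_min (\<lambda>t. R (z t)) (\<lambda>t. True) (W / U) \<and> z (W / U) \<in> half_space c \<and>
        is_min_value R (span {x, v}) (R (z (W / U)))) \<and>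
     (U \<le> 0 \<longrightarrow>
        (mono (\<lambda>t. R (z t)) \<or> antimono (\<lambda>t. R (z t))) \<and>
        (INF t. R (z t)) = min (R (- v)) (R v) \<and>
        (U = 0 \<longrightarrow> is_min_value R (span {x, v}) (min (R (- v)) (R v))))"
    if nc: "\<not> collinear_vectors (Q *v x) (Q *v v)"
  proof -
    define \<Delta> where "\<Delta> = a * d - b\<^sup>2"
    define g where "g = (U / \<Delta>) *\<^sub>R x + (W / \<Delta>) *\<^sub>R v"
    have \<Delta>: "\<Delta> > 0" using pos_semidef_gram_pos[OF Q nc] by (simp add: \<Delta>_def a_def b_def d_def)
    have g_span: "g \<in> span {x, v}" unfolding g_def mem_span_pair by blast
    have proj: "c \<bullet> w = w \<bullet> (Q *v g)" if "w \<in> span {x, v}" for w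
      using Upsilon_projection[OF Q \<alpha> nc _ _ that] \<Delta>_def g_def
      by (simp add: a_def b_def d_def U_def W_def)
    have g_min: "is_min_value R (span {x, v}) (R g)"
      unfolding R by (rule R_map_min_of_projection[OF Q \<alpha> subspace_span g_span proj])
    have "Q *v g \<noteq> 0" using proj[of x] p by (auto simp: p_def span_base)
    then have cg: "c \<bullet> g > 0"
      using pos_semidef_quadratic_form_pos[OF Q] proj[OF g_span] by simp
    have case_pos: "is_arg_min (\<lambda>t. R (z t)) (\<lambda>t. True) (W / U)
        \<and> z (W / U) \<in> half_space c \<and> is_min_value R (span {x, v}) (R (z (W / U)))" if U: "U > 0"
    proof -
      have zg: "z (W / U) = (\<Delta> / U) *\<^sub>R g"
        using U \<Delta> by (simp add: z g_def scaleR_add_right)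
      then have "R (z (W / U)) = R g"
        using U \<Delta> by (simp add: R R_map_scaleR[OF Q \<alpha>])
      moreover have "z (W / U) \<in> half_space c"
        using cg U \<Delta> by (simp add: zg half_space_def)
      moreover have "R g \<le> R (z t)" for t
        using g_min z_span[of t] by (simp add: is_min_value_def)
      ultimately show ?thesis
        using g_min by (simp add: is_arg_min_def not_less)
    qed
    have case_nonpos: "(mono (\<lambda>t. R (z t)) \<or> antimono (\<lambda>t. R (z t)))
        \<and> (INF t. R (z t)) = min (R (- v)) (R v)" if U: "U \<le> 0"
    proof -
      have "a * d > 0" using \<Delta> zero_le_power2[of b] unfolding \<Delta>_def by linarith
      then have "d > 0" using a by (simp add: zero_less_mult_iff)
      then have "r * b > 0" using U mult_pos_pos[OF p, of d] by (simp add: U_eq)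
      then consider "r > 0" | "r < 0" by (auto simp: zero_less_mult_iff)
      then show ?thesis
      proof cases
        case 1
        then have v: "v \<in> half_space c" and "- v \<notin> half_space c"
          by (simp_all add: half_space_def r_def)
        then have "R v \<le> R (- v)"
          using R_map_le[OF Q \<alpha>, of v] by (simp add: R R_map_closed_form[OF Q \<alpha>, of "- v"])
        then show ?thesis
          using antimono_R_map_line[OF Q \<alpha> v, of x] INF_R_map_line[OF Q \<alpha> v, of x] U
          by (simp add: R z U_def)
      next
        \<comment> \<open>Replacing \<open>v\<close> with \<open>- v\<close> reverses the line and leaves \<open>Upsilon Q c v x\<close> unchanged.\<close>
        case 2
        then have v: "- v \<in> half_space c" and "v \<notin> half_space c"
          by (simp_all add: half_space_def r_def)
        then have le: "R (- v) \<le> R v"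
          using R_map_le[OF Q \<alpha>, of "- v"] by (simp add: R R_map_closed_form[OF Q \<alpha>, of v])
        have neg: "Q *v (- v) = - (Q *v v)"
          using matrix_vector_mult_scaleR[of Q "- 1" v] by simp
        have U': "Upsilon Q c (- v) x \<le> 0"
          using U by (simp add: U_def Upsilon_def neg)
        have rev: "R (z t) = R_map Q c \<alpha> (x + (- t) *\<^sub>R (- v))" for t
          by (simp add: R z)
        have "mono (\<lambda>t. R (z t))"
          unfolding rev
          by (rule monoI) (rule antimonoD[OF antimono_R_map_line[OF Q \<alpha> v U']], simp)
        moreover have "(\<lambda>t. R (z t)) = (\<lambda>t. R_map Q c \<alpha> (x + t *\<^sub>R (- v))) \<circ> uminus"
          unfolding rev by auto
        then have "range (\<lambda>t. R (z t)) = range (\<lambda>t. R_map Q c \<alpha> (x + t *\<^sub>R (- v)))"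
          by (metis image_comp surj_uminus)
        then have "(INF t. R (z t)) = R (- v)"
          using INF_R_map_line[OF Q \<alpha> v U'] by (simp add: R)
        ultimately show ?thesis using le by (simp add: min_def)
      qed
    qed
    have case_zero: "is_min_value R (span {x, v}) (min (R (- v)) (R v))" if U: "U = 0"
    proof -
      have gv: "g = (W / \<Delta>) *\<^sub>R v" by (simp add: g_def U)
      then have "W \<noteq> 0" using cg by auto
      then have "R g = R v \<or> R g = R (- v)"
      proof (cases "W > 0")
        case True
        then show ?thesis using gv \<Delta> by (simp add: R R_map_scaleR[OF Q \<alpha>])
      next
        case False
        then have "- W / \<Delta> > 0" using \<open>W \<noteq> 0\<close> \<Delta> by (intro divide_pos_pos) auto
        moreover have "g = (- W / \<Delta>) *\<^sub>R (- v)" by (simp add: gv)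
        ultimately show ?thesis using R_map_scaleR[OF Q \<alpha>] unfolding R by metis
      qed
      moreover have "R g \<le> R v" "R g \<le> R (- v)"
        using g_min by (auto simp: is_min_value_def span_base span_neg)
      ultimately have "min (R (- v)) (R v) = R g" by auto
      then show ?thesis using g_min by simp
    qed
    show ?thesis using case_pos case_nonpos case_zero by blast
  qed
  have collinear: "piecewise_constant_on R (span {x, v}) \<and> R ` span {x, v} = {R 0, R x} \<and>
      R x < R 0 \<and> is_arg_min (\<lambda>t. R (z t)) (\<lambda>t. True) 0"
    if col: "collinear_vectors (Q *v x) (Q *v v)"
  proof -
    have Qx: "Q *v x \<noteq> 0" using a by (auto simp: a_def)
    obtain \<beta> \<gamma> where \<beta>\<gamma>: "\<beta> \<noteq> 0 \<or> \<gamma> \<noteq> 0" "\<beta> *\<^sub>R (Q *v x) + \<gamma> *\<^sub>R (Q *v v) = 0"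
      using col unfolding collinear_vectors_def by blast
    have "\<gamma> \<noteq> 0" using \<beta>\<gamma> Qx by auto
    define l where "l = - \<beta> / \<gamma>"
    have "\<gamma> *\<^sub>R (Q *v v) = (- \<beta>) *\<^sub>R (Q *v x)"
      using \<beta>\<gamma>(2) by (simp add: eq_neg_iff_add_eq_0 add.commute)
    then have Qv: "Q *v v = l *\<^sub>R (Q *v x)"
      using \<open>\<gamma> \<noteq> 0\<close> unfolding l_def
      by (metis (no_types, lifting) divide_inverse_commute eq_vector_fraction_iff scaleR_scaleR)
    have R0: "R 0 = c \<bullet> \<alpha>" by (simp add: R R_map_closed_form[OF Q \<alpha>] half_space_def)
    have Rx: "R x = c \<bullet> \<alpha> - p\<^sup>2 / a"
      using x by (simp add: R R_map_closed_form[OF Q \<alpha>] p_def a_def)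
    have less: "R x < R 0" using p a by (simp add: R0 Rx)
    \<comment> \<open>Every \<open>w\<close> in the span is a multiple of \<open>x\<close> modulo the kernel of \<open>Q\<close>, and \<open>c = Q *v \<alpha>\<close> is
      orthogonal to this kernel.\<close>
    have R_span: "R w = (if w \<in> half_space c then R x else R 0)" if w: "w \<in> span {x, v}" for w
    proof -
      obtain s u where w_eq: "w = s *\<^sub>R x + u *\<^sub>R v" using w by (auto simp: mem_span_pair)
      have Qw: "Q *v w = (s + u * l) *\<^sub>R (Q *v x)"
        by (simp add: w_eq matrix_vector_right_distrib matrix_vector_mult_scaleR Qv
            scaleR_add_left)
      have cQ: "c \<bullet> y = \<alpha> \<bullet> (Q *v y)" for y
        using pos_semidef_symmetric[OF Q, of y \<alpha>] by (simp add: \<alpha> inner_commute)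
      have cw: "c \<bullet> w = (s + u * l) * p" unfolding cQ Qw by (simp add: p_def cQ)
      have "w \<bullet> (Q *v x) = (s + u * l) * a"
        using pos_semidef_symmetric[OF Q, of w x] by (simp add: Qw a_def)
      then have qw: "w \<bullet> (Q *v w) = (s + u * l)\<^sup>2 * a"
        by (simp add: Qw power2_eq_square)
      show ?thesis
      proof (cases "w \<in> half_space c")
        case True
        then have "s + u * l \<noteq> 0" by (auto simp: half_space_def cw)
        moreover have "R w = c \<bullet> \<alpha> - (c \<bullet> w)\<^sup>2 / (w \<bullet> (Q *v w))"
          using True by (simp add: R R_map_closed_form[OF Q \<alpha>])
        ultimately have "R w = R x" by (simp add: cw qw Rx power_mult_distrib)
        then show ?thesis using True by simp
      next
        case False
        then show ?thesis unfolding R0 by (simp add: R R_map_closed_form[OF Q \<alpha>])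
      qed
    qed
    have x_span: "x \<in> span {x, v}" by (simp add: span_base)
    have zero: "0 \<in> span {x, v}" "0 \<notin> half_space c"
      by (simp_all add: span_zero half_space_def)
    define S where "S = span {x, v} \<inter> half_space c"
    define T where "T = span {x, v} - half_space c"
    have "T = span {x, v} \<inter> {w. c \<bullet> w \<le> 0}" by (auto simp: T_def half_space_def)
    then have "convex S" "convex T"
      unfolding S_def half_space_def
      by (simp_all add: convex_Int convex_halfspace_gt convex_halfspace_le
          subspace_imp_convex)
    moreover have "R constant_on S" "R constant_on T"
      unfolding constant_on_def S_def T_def using R_span by auto
    moreover have "partition_on (span {x, v}) {S, T}"
      using x x_span zero by (auto simp: partition_on_def disjoint_def S_def T_def)
    ultimately have "piecewise_constant_on R (span {x, v})"
      unfolding piecewise_constant_on_def by (intro exI[of _ "{S, T}"]) auto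
    moreover have "R ` span {x, v} = {R 0, R x}"
    proof
      show "R ` span {x, v} \<subseteq> {R 0, R x}"
      proof
        fix y assume "y \<in> R ` span {x, v}"
        then obtain w where "w \<in> span {x, v}" "y = R w" by blast
        then show "y \<in> {R 0, R x}" using R_span[of w] by (metis insertCI)
      qed
      show "{R 0, R x} \<subseteq> R ` span {x, v}" using x_span zero(1) by blast
    qed
    moreover have "R x \<le> R (z t)" for t using R_span[OF z_span[of t]] less by simp
    then have "is_arg_min (\<lambda>t. R (z t)) (\<lambda>t. True) 0"
      by (simp add: is_arg_min_def not_less) (simp add: z)
    ultimately show ?thesis using less by blast
  qed
  show ?thesis
    using noncollinear collinear unfolding U_def W_def Let_def by blast
qed

end
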